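(* Let $\mathcal{M}_1,\ldots,\mathcal{M}_k$ be matroids on the finite ground set $V$, and let $v\in V$. Then either \[\eta(\mathcal{M}_1\cap\cdots\cap\mathcal{M}_k)\ge \eta\big((\mathcal{M}_1\sim v)\cap\mathcal{M}_2\cap\cdots\cap\mathcal{M}_k\big),\] or there exists a set $C\subseteq V$ such that (i) $v\in C$; (ii) $C$ is a circuit of $\mathcal{M}_1$; (iii) $C\in\bigcap_{i=2}^k\mathcal{M}_i$; and (iv) \[\eta(\mathcal{M}_1\cap\cdots\cap\mathcal{M}_k)\ge \eta\big((\mathcal{M}_1/C)\cap\cdots\cap(\mathcal{M}_k/C)\big)+|C|-1.\]
   Context: A matroid on $V$ is a nonempty family of subsets of $V$ (independent sets) closed under subsets and satisfying the augmentation axiom (if $S,T$ independent and $|S|<|T|$ then some $x\in T\setminus S$ has $S\cup\{x\}$ independent). A circuit of a matroid $\mathcal{M}$ is a minimal non-independent subset of $V$. For $X\subseteq V$, the contraction $\mathcal{M}/X$ is the complex on $V\setminus X$ consisting of all $S\subseteq V\setminus X$ that contain no set of the form $e\setminus X$ with $e$ a circuit of $\mathcal{M}$ and $e\not\subseteq X$. For $v\in V$, $\mathcal{M}\sim v$ is the complex on $V$ consisting of all $S\subseteq V$ that contain no circuit $e$ of $\mathcal{M}$ with $v\notin e$ (equivalently, $S\setminus\{v\}\in\mathcal{M}$). Intersections of complexes are taken setwise. For a simplicial complex $\mathcal{C}$ and a fixed coefficient ring $R$, the homological connectivity $\eta(\mathcal{C})$ is the minimal $k$ such that the reduced homology $\tilde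 H_{k-1}(\mathcal{C};R)$ is nonzero; $\eta(\mathcal{C})=0$ if $\mathcal{C}$ is the empty complex, and $\eta(\mathcal{C})=\infty$ if all reduced homology groups vanish. *)

theory Defs
  imports "HOL-Algebra.Elementary_Groups" "HOL-Combinatorics.Permutations" "HOL-Library.Extended_Nat"
begin

definition matroid :: "'a set \<Rightarrow> 'a set set \<Rightarrow> bool" where
  "matroid V M \<longleftrightarrow>
     M \<subseteq> Pow V \<and> M \<noteq> {} \<and>
     (\<forall>S\<in>M. \<forall>T. T \<subseteq> S \<longrightarrow> T \<in> M) \<and>
     (\<forall>S\<in>M. \<forall>T\<in>M. card S < card T \<longrightarrow> (\<exists>x\<in>T - S. insert x S \<in> M))"

definition circuit :: "'a set \<Rightarrow> 'a set set \<Rightarrow> 'a set \<Rightarrow> bool" where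
  "circuit V M C \<longleftrightarrow> C \<subseteq> V \<and> C \<notin> M \<and> (\<forall>D. D \<subset> C \<longrightarrow> D \<in> M)"

definition contraction :: "'a set \<Rightarrow> 'a set set \<Rightarrow> 'a set \<Rightarrow> 'a set set" where
  "contraction V M X =
     {S. S \<subseteq> V - X \<and> \<not> (\<exists>e. circuit V M e \<and> \<not> e \<subseteq> X \<and> e - X \<subseteq> S)}"

text \<open>The complex written \<open>M \<sim> v\<close>: circuits through \<open>v\<close> are dropped, the ground set stays \<open>V\<close>.\<close>

definition drop_circuits :: "'a set \<Rightarrow> 'a set set \<Rightarrow> 'a \<Rightarrow> 'a set set" where
  "drop_circuits V M v = {S. S \<subseteq> V \<and> \<not> (\<exists>e. circuit V M e \<and> v \<notin> e \<and> e \<subseteq> S)}"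

text \<open>
  Simplicial complexes are families of sets. Oriented \<open>p\<close>-chains of \<open>K\<close> are alternating,
  finitely supported functions on the orderings of the \<open>p\<close>-dimensional faces, so that no order
  on the vertices has to be chosen: \<open>c [v\<^sub>0, \<dots>, v\<^sub>p]\<close> is the coefficient of the oriented simplex
  \<open>[v\<^sub>0, \<dots>, v\<^sub>p]\<close>. For \<open>p = -1\<close> the only candidate face is the empty one (the empty list), which
  makes the chain complex the augmented one.
\<close>

definition chains :: "'a set set \<Rightarrow> int \<Rightarrow> ('a list \<Rightarrow> 'r::ring_1) set" where
  "chains K p =
     {c. finite {xs. c xs \<noteq> 0} \<and>
         (\<forall>xs. c xs \<noteq> 0 \<longrightarrow> distinct xs \<and> set xs \<in> K \<and> int (length xs) = p + 1) \<and>
         (\<forall>xs \<pi>. \<pi> permutes {..<length xs} \<longrightarrow>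
            c (permute_list \<pi> xs) = of_int (sign \<pi>) * c xs)}"

definition chain_group :: "'a set set \<Rightarrow> int \<Rightarrow> ('a list \<Rightarrow> 'r::ring_1) monoid" where
  "chain_group K p =
     \<lparr>carrier = chains K p, monoid.mult = (\<lambda>c d xs. c xs + d xs), one = (\<lambda>_. 0)\<rparr>"

text \<open>
  The usual boundary \<open>[v\<^sub>0, \<dots>, v\<^sub>p] \<mapsto> (\<Sum>i\<le>p. (-1)^i [v\<^sub>0, \<dots>, v\<^sub>i\<^sub>-\<^sub>1, v\<^sub>i\<^sub>+\<^sub>1, \<dots>, v\<^sub>p])\<close> in terms of
  coefficients: by alternation, the oriented simplices having \<open>xs\<close> as a face can be written
  \<open>x # xs\<close>, in which \<open>xs\<close> occurs with sign \<open>+1\<close>. On \<open>(-1)\<close>-chains it vanishes.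
\<close>

definition boundary :: "('a list \<Rightarrow> 'r::ring_1) \<Rightarrow> 'a list \<Rightarrow> 'r" where
  "boundary c = (\<lambda>xs. \<Sum>x | c (x # xs) \<noteq> 0. c (x # xs))"

definition cycle_group :: "'a set set \<Rightarrow> int \<Rightarrow> ('a list \<Rightarrow> 'r::ring_1) monoid" where
  "cycle_group K p = (chain_group K p)\<lparr>carrier := {c \<in> chains K p. boundary c = (\<lambda>_. 0)}\<rparr>"

definition reduced_homology_group ::
    "'a set set \<Rightarrow> int \<Rightarrow> ('a list \<Rightarrow> 'r::ring_1) set monoid" where
  "reduced_homology_group K p = cycle_group K p Mod (boundary ` chains K (p + 1))"

text \<open>
  The explicit case concerns the complex without any face; for the complex whose only face is the
  empty set, the second case yields \<open>0\<close>, since its reduced homology in degree \<open>-1\<close> is the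
  coefficient ring. Reduced homology vanishes below degree \<open>-1\<close>, and \<open>Inf {} = \<infinity>\<close>.
\<close>

definition hconn :: "'r::ring_1 itself \<Rightarrow> 'a set set \<Rightarrow> enat" where
  "hconn R K =
     (if K = {} then 0
      else Inf {enat k | k.
        \<not> trivial_group (reduced_homology_group K (int k - 1) :: ('a list \<Rightarrow> 'r) set monoid)})"

end

theory Submission imports Defs
begin

text \<open>
  Let \<open>N = (M\<^sub>1 \<sim> v) \<inter> M\<^sub>2 \<inter> \<dots> \<inter> M\<^sub>k\<close>. By circuit elimination every face of \<open>N\<close> outside
  \<open>K = M\<^sub>1 \<inter> \<dots> \<inter> M\<^sub>k\<close> contains exactly one circuit \<open>C \<ni> v\<close> of \<open>M\<^sub>1\<close>, so \<open>K\<close> arises from \<open>N\<close>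
  by deleting disjoint open stars of such circuits, and the link of \<open>C\<close> in \<open>N\<close> is the
  intersection of the contractions \<open>M\<^sub>i / C\<close>. Deleting the open star of \<open>C\<close> can make a
  bounding \<open>j\<close>-cycle non-bounding only if the link of \<open>C\<close> has homology in degree \<open>j + 1 - |C|\<close>.
  Applied to a cycle of \<open>K\<close> in the lowest degree with nonzero homology, this gives the alternative.
\<close>

section \<open>Alternating chains\<close>

text \<open>\<open>chains\<close> permutes positions, while later arguments permute vertices. For a
  distinct list, \<open>nth xs\<close> is a bijection from positions to entries, and transporting
  \<sigma> along it preserves the sign.\<close>

lemma permute_list_eq_map:
  assumes "distinct xs" "\<sigma> permutes {..<length xs}"
  obtains \<pi> where "\<pi> permutes set xs" "map \<pi> xs = permute_list \<sigma> xs" "sign \<pi> = sign \<sigma>"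
proof
  let ?\<pi> = "map_permutation {..<length xs} (nth xs) \<sigma>"
  have bij: "bij_betw (nth xs) {..<length xs} (set xs)"
    using assms(1) by (simp add: bij_betw_nth)
  show "?\<pi> permutes set xs"
    by (rule map_permutation_permutes[OF bij assms(2)])
  show "map ?\<pi> xs = permute_list \<sigma> xs"
  proof (rule nth_equalityI)
    fix i assume "i < length (map ?\<pi> xs)"
    then show "map ?\<pi> xs ! i = permute_list \<sigma> xs ! i"
      using assms by (simp add: permute_list_nth map_permutation_apply[OF bij_betw_imp_inj_on[OF bij]])
  qed simp
  show "sign ?\<pi> = sign \<sigma>"
    by (rule sign_map_permutation) (use bij assms in \<open>auto simp: bij_betw_def\<close>)
qed

lemma permutes_eq_if_map_eq:
  assumes "\<pi> permutes set xs" "\<rho> permutes set xs" "map \<pi> xs = map \<rho> xs"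
  shows "\<pi> = \<rho>"
proof
  fix x show "\<pi> x = \<rho> x"
    using assms by (cases "x \<in> set xs") (auto simp: permutes_not_in)
qed

text \<open>The converse translation. The sign carries over because a permutation of
  \<open>set xs\<close> is determined by its effect on \<open>xs\<close>, so going back from
  \<sigma> can only return \<pi>.\<close>

lemma map_eq_permute_list:
  assumes "distinct xs" "\<pi> permutes set xs"
  obtains \<sigma> where "\<sigma> permutes {..<length xs}" "permute_list \<sigma> xs = map \<pi> xs" "sign \<sigma> = sign \<pi>"
proof -
  have "distinct (map \<pi> xs)" "set (map \<pi> xs) = set xs"
    using assms by (simp_all add: distinct_map permutes_inj_on permutes_image)
  then have "mset (map \<pi> xs) = mset xs"
    using assms(1) set_eq_iff_mset_eq_distinct by blast
  then obtain \<sigma> where \<sigma>: "\<sigma> permutes {..<length xs}" "permute_list \<sigma> xs = map \<pi> xs"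
    by (rule mset_eq_permutation)
  obtain \<rho> where \<rho>: "\<rho> permutes set xs" "map \<rho> xs = permute_list \<sigma> xs" "sign \<rho> = sign \<sigma>"
    by (rule permute_list_eq_map[OF assms(1) \<sigma>(1)])
  have "\<rho> = \<pi>"
    using \<rho>(1) assms(2) by (rule permutes_eq_if_map_eq) (simp add: \<rho>(2) \<sigma>(2))
  with \<rho>(3) \<sigma> show ?thesis by (intro that) simp_all
qed

lemma ex_map_permutes:
  assumes "distinct xs" "distinct ys" "set xs = set ys"
  shows "\<exists>\<pi>. \<pi> permutes set xs \<and> map \<pi> xs = ys"
proof -
  have "mset ys = mset xs"
    using assms set_eq_iff_mset_eq_distinct by blast
  then obtain \<sigma> where \<sigma>: "\<sigma> permutes {..<length xs}" "permute_list \<sigma> xs = ys"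
    by (rule mset_eq_permutation)
  obtain \<pi> where "\<pi> permutes set xs" "map \<pi> xs = permute_list \<sigma> xs"
    by (rule permute_list_eq_map[OF assms(1) \<sigma>(1)])
  with \<sigma>(2) show ?thesis by blast
qed

lemma chains_support:
  assumes "c \<in> chains K p" "c xs \<noteq> 0"
  shows "distinct xs" "set xs \<in> K" "int (length xs) = p + 1"
  using assms by (auto simp: chains_def)

lemma chains_map:
  fixes c :: "'a list \<Rightarrow> 'r::ring_1"
  assumes "c \<in> chains K p" "distinct xs" "\<pi> permutes set xs"
  shows "c (map \<pi> xs) = of_int (sign \<pi>) * c xs"
proof -
  obtain \<sigma> where \<sigma>: "\<sigma> permutes {..<length xs}" "permute_list \<sigma> xs = map \<pi> xs" "sign \<sigma> = sign \<pi>"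
    by (rule map_eq_permute_list[OF assms(2,3)])
  have "c (permute_list \<sigma> xs) = of_int (sign \<sigma>) * c xs"
    using assms(1) \<sigma>(1) by (simp add: chains_def)
  then show ?thesis by (simp only: \<sigma>)
qed

text \<open>The working form of alternation, with vertices permuted instead of positions. Finite
  support is automatic, since the support consists of distinct lists over the finite
  \<open>V\<close>. On lists with repetitions both values are zero.\<close>

lemma chains_iff:
  fixes c :: "'a list \<Rightarrow> 'r::ring_1"
  assumes "finite V" "K \<subseteq> Pow V"
  shows "c \<in> chains K p \<longleftrightarrow>
    (\<forall>xs. c xs \<noteq> 0 \<longrightarrow> distinct xs \<and> set xs \<in> K \<and> int (length xs) = p + 1) \<and>
    (\<forall>xs \<pi>. distinct xs \<longrightarrow> \<pi> permutes set xs \<longrightarrow> c (map \<pi> xs) = of_int (sign \<pi>) * c xs)"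
    (is "_ \<longleftrightarrow> ?S \<and> ?A")
proof
  assume c: "c \<in> chains K p"
  show "?S \<and> ?A" using chains_support[OF c] chains_map[OF c] by blast
next
  assume c: "?S \<and> ?A"
  have "{xs. c xs \<noteq> 0} \<subseteq> {xs. set xs \<subseteq> V \<and> distinct xs}"
    using c assms(2) by auto
  then have fin: "finite {xs. c xs \<noteq> 0}"
    using finite_subset_distinct[OF assms(1)] by (rule finite_subset)
  have "c (permute_list \<sigma> xs) = of_int (sign \<sigma>) * c xs" if \<sigma>: "\<sigma> permutes {..<length xs}" for xs \<sigma>
  proof (cases "distinct xs")
    case True
    obtain \<pi> where \<pi>: "\<pi> permutes set xs" "map \<pi> xs = permute_list \<sigma> xs" "sign \<pi> = sign \<sigma>"
      by (rule permute_list_eq_map[OF True \<sigma>])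
    have "c (map \<pi> xs) = of_int (sign \<pi>) * c xs" using c True \<pi>(1) by blast
    then show ?thesis by (simp only: \<pi>)
  next
    case False
    then have "\<not> distinct (permute_list \<sigma> xs)" using \<sigma> by simp
    then have "c xs = 0" "c (permute_list \<sigma> xs) = 0" using c False by blast+
    then show ?thesis by simp
  qed
  with c fin show "c \<in> chains K p" by (auto simp: chains_def)
qed

section \<open>Additive structure of the chains\<close>

lemma zero_in_chains: "(\<lambda>_. 0) \<in> chains K p"
  by (simp add: chains_def)

lemma chains_diff:
  assumes "c \<in> chains K p" "d \<in> chains K p"
  shows "(\<lambda>xs. c xs - d xs) \<in> chains K p"
proof -
  have "finite {xs. c xs - d xs \<noteq> 0}"
    by (rule finite_subset[of _ "{xs. c xs \<noteq> 0} \<union> {xs. d xs \<noteq> 0}"])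
      (use assms in \<open>auto simp: chains_def\<close>)
  moreover have "distinct xs \<and> set xs \<in> K \<and> int (length xs) = p + 1" if "c xs - d xs \<noteq> 0" for xs
  proof -
    have "c xs \<noteq> 0 \<or> d xs \<noteq> 0" using that by auto
    then show ?thesis using assms chains_support by blast
  qed
  moreover have "c (permute_list \<pi> xs) - d (permute_list \<pi> xs) = of_int (sign \<pi>) * (c xs - d xs)"
    if "\<pi> permutes {..<length xs}" for xs \<pi>
    using assms that by (simp add: chains_def right_diff_distrib)
  ultimately show ?thesis by (simp add: chains_def)
qed

lemma chains_add:
  assumes "c \<in> chains K p" "d \<in> chains K p"
  shows "(\<lambda>xs. c xs + d xs) \<in> chains K p"
  using chains_diff[OF assms(1) chains_diff[OF zero_in_chains assms(2)]] by simp

lemma chains_below: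
  assumes "c \<in> chains K p" "p < -1"
  shows "c = (\<lambda>_. 0)"
  using chains_support(3)[OF assms(1)] assms(2) by fastforce

text \<open>The index set in \<open>boundary\<close> varies with the chain; summing over the fixed
  set \<open>V\<close> instead makes linearity visible and lets double boundaries be
  rearranged.\<close>

lemma boundary_eq_sum:
  assumes "finite V" "K \<subseteq> Pow V" "c \<in> chains K p"
  shows "boundary c xs = (\<Sum>x\<in>V. c (x # xs))"
  unfolding boundary_def
proof (rule sum.mono_neutral_left)
  show "{x. c (x # xs) \<noteq> 0} \<subseteq> V"
    using chains_support(2)[OF assms(3)] assms(2) by fastforce
qed (use assms in auto)

lemma boundary_zero: "boundary (\<lambda>_. 0) = (\<lambda>_. 0)"
  by (simp add: boundary_def)

lemma boundary_diff:
  assumes "finite V" "K \<subseteq> Pow V" "c \<in> chains K p" "d \<in> chains K p"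
  shows "boundary (\<lambda>xs. c xs - d xs) = (\<lambda>xs. boundary c xs - boundary d xs)"
  unfolding fun_eq_iff boundary_eq_sum[OF assms(1-3)] boundary_eq_sum[OF assms(1,2,4)]
    boundary_eq_sum[OF assms(1,2) chains_diff[OF assms(3,4)]] by (simp add: sum_subtractf)

lemma boundary_add:
  assumes "finite V" "K \<subseteq> Pow V" "c \<in> chains K p" "d \<in> chains K p"
  shows "boundary (\<lambda>xs. c xs + d xs) = (\<lambda>xs. boundary c xs + boundary d xs)"
  unfolding fun_eq_iff boundary_eq_sum[OF assms(1-3)] boundary_eq_sum[OF assms(1,2,4)]
    boundary_eq_sum[OF assms(1,2) chains_add[OF assms(3,4)]] by (simp add: sum.distrib)

section \<open>Families closed under subsets\<close>

definition subset_closed :: "'a set set \<Rightarrow> bool" where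
  "subset_closed K \<longleftrightarrow> (\<forall>S\<in>K. \<forall>T. T \<subseteq> S \<longrightarrow> T \<in> K)"

lemma subset_closedD: "subset_closed K \<Longrightarrow> S \<in> K \<Longrightarrow> T \<subseteq> S \<Longrightarrow> T \<in> K"
  by (auto simp: subset_closed_def)

lemma subset_closed_Int: "subset_closed K \<Longrightarrow> subset_closed L \<Longrightarrow> subset_closed (K \<inter> L)"
  unfolding subset_closed_def by blast

lemma subset_closed_INT:
  assumes "\<And>i. i \<in> I \<Longrightarrow> subset_closed (K i)"
  shows "subset_closed (\<Inter>i\<in>I. K i)"
  unfolding subset_closed_def
proof (intro ballI allI impI INT_I)
  fix S T i assume "S \<in> (\<Inter>i\<in>I. K i)" "T \<subseteq> S" "i \<in> I"
  then show "T \<in> K i" using subset_closedD[OF assms, of i S T] by simp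
qed

lemma subset_closed_avoiding:
  "subset_closed K \<Longrightarrow> subset_closed {S \<in> K. \<forall>C\<in>\<D>. \<not> C \<subseteq> S}"
  unfolding subset_closed_def by blast

lemma subset_closed_link:
  assumes "subset_closed K"
  shows "subset_closed {T. T \<inter> C = {} \<and> T \<union> C \<in> K}"
  unfolding subset_closed_def
proof (intro ballI allI impI CollectI conjI)
  fix S T assume S: "S \<in> {T. T \<inter> C = {} \<and> T \<union> C \<in> K}" and "T \<subseteq> S"
  then show "T \<inter> C = {}" by blast
  have "T \<union> C \<subseteq> S \<union> C" using \<open>T \<subseteq> S\<close> by blast
  with S show "T \<union> C \<in> K" using subset_closedD[OF assms] by blast
qed

section \<open>The augmented chain complex\<close>

lemma boundary_in_chains:
  fixes c :: "'a list \<Rightarrow> 'r::ring_1"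
  assumes V: "finite V" "K \<subseteq> Pow V" and K: "subset_closed K" and c: "c \<in> chains K (p + 1)"
  shows "boundary c \<in> chains K p"
  unfolding chains_iff[OF V]
proof (intro conjI allI impI)
  fix xs assume "boundary c xs \<noteq> 0"
  then obtain x where "c (x # xs) \<noteq> 0"
    unfolding boundary_eq_sum[OF V c] by (meson sum.neutral)
  from chains_support[OF c this] subset_closedD[OF K]
  show "distinct xs" "set xs \<in> K" "int (length xs) = p + 1" by auto
next
  fix xs :: "'a list" and \<pi> assume xs: "distinct xs" and \<pi>: "\<pi> permutes set xs"
  have "c (x # map \<pi> xs) = of_int (sign \<pi>) * c (x # xs)" for x
  proof (cases "x \<in> set xs")
    case True
    then have "x \<in> set (map \<pi> xs)" using \<pi> by (simp add: permutes_image)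
    then have "c (x # map \<pi> xs) = 0" using chains_support(1)[OF c] by fastforce
    moreover have "c (x # xs) = 0" using True chains_support(1)[OF c] by fastforce
    ultimately show ?thesis by simp
  next
    case False
    \<comment> \<open>A permutation of \<open>set xs\<close> fixes the new vertex \<open>x\<close>,
      so it acts on \<open>x # xs\<close> with the same sign.\<close>
    have "\<pi> permutes set (x # xs)" using \<pi> by (rule permutes_subset) auto
    moreover have "\<pi> x = x" using \<pi> False by (rule permutes_not_in)
    ultimately show ?thesis using chains_map[OF c, of "x # xs" \<pi>] False xs by simp
  qed
  then show "boundary c (map \<pi> xs) = of_int (sign \<pi>) * boundary c xs"
    by (simp add: boundary_eq_sum[OF V c] sum_distrib_left)
qed

text \<open>Terms off the diagonal cancel in pairs. The diagonal has its own hypothesis, as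
  antisymmetry says nothing about it when \<open>1 + 1 = 0\<close> in the coefficients.\<close>

lemma sum_alternating:
  fixes f :: "'a \<Rightarrow> 'a \<Rightarrow> 'r::ab_group_add"
  assumes "finite A" "\<And>x. f x x = 0" "\<And>x y. f x y = - f y x"
  shows "(\<Sum>x\<in>A. \<Sum>y\<in>A. f x y) = 0"
  using assms(1)
proof (induction A rule: finite_induct)
  case (insert a A)
  have "(\<Sum>x\<in>A. f x a) = - (\<Sum>x\<in>A. f a x)"
    unfolding sum_negf[symmetric] by (rule sum.cong[OF refl]) (rule assms(3))
  with insert show ?case by (simp add: sum.distrib assms(2))
qed simp

text \<open>The double boundary is a sum over pairs of vertices put in front of \<open>xs\<close>.
  Exchanging the two is a transposition, so the summand is alternating.\<close>

lemma boundary_boundary: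
  fixes c :: "'a list \<Rightarrow> 'r::ring_1"
  assumes V: "finite V" "K \<subseteq> Pow V" and K: "subset_closed K" and c: "c \<in> chains K (p + 1)"
  shows "boundary (boundary c) = (\<lambda>_. 0)"
proof
  fix xs :: "'a list"
  have diag: "c (x # x # xs) = 0" for x
    using chains_support(1)[OF c, of "x # x # xs"] by auto
  have swap: "c (y # x # xs) = - c (x # y # xs)" for x y
  proof (cases "distinct (x # y # xs)")
    case True
    let ?t = "Transposition.transpose x y"
    have "?t permutes set (x # y # xs)" by (rule permutes_swap_id) auto
    moreover have "map ?t (x # y # xs) = y # x # xs"
      using True by (simp, intro map_idI transpose_apply_other) auto
    ultimately show ?thesis
      using chains_map[OF c True, of ?t] True by (simp add: sign_swap_id)
  next
    case False
    then have "\<not> distinct (y # x # xs)" by auto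
    with False have "c (x # y # xs) = 0" "c (y # x # xs) = 0"
      using chains_support(1)[OF c] by blast+
    then show ?thesis by simp
  qed
  show "boundary (boundary c) xs = 0"
    unfolding boundary_eq_sum[OF V boundary_in_chains[OF V K c]] boundary_eq_sum[OF V c]
    by (rule sum_alternating[OF V(1), of "\<lambda>x y. c (y # x # xs)", OF diag swap])
qed

section \<open>Vanishing of homology\<close>

text \<open>An elementwise form of vanishing homology, so that single cycles can be handled in place
  of cosets.\<close>

definition acyclic_at :: "'r::ring_1 itself \<Rightarrow> 'a set set \<Rightarrow> int \<Rightarrow> bool" where
  "acyclic_at R K p \<longleftrightarrow>
    (\<forall>c \<in> chains K p :: ('a list \<Rightarrow> 'r) set. boundary c = (\<lambda>_. 0) \<longrightarrow> c \<in> boundary ` chains K (p + 1))"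

lemma acyclic_at_below:
  fixes R :: "'r::ring_1 itself" and K :: "'a set set"
  assumes "p < -1"
  shows "acyclic_at R K p"
  unfolding acyclic_at_def
proof (intro ballI impI)
  fix c :: "'a list \<Rightarrow> 'r" assume "c \<in> chains K p"
  then have "c = boundary (\<lambda>_. 0)"
    using chains_below[OF _ assms] by (simp add: boundary_zero)
  then show "c \<in> boundary ` chains K (p + 1)" using zero_in_chains by blast
qed

text \<open>Most of the work is to see that cycles form an abelian group with the boundaries as a
  subgroup, normal by commutativity. Only then can the quotient be computed with.\<close>

lemma trivial_homology_iff:
  assumes V: "finite V" "K \<subseteq> Pow V" and K: "subset_closed K"
  shows "trivial_group (reduced_homology_group K p :: ('a list \<Rightarrow> 'r::ring_1) set monoid)
    \<longleftrightarrow> acyclic_at TYPE('r) K p"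
proof -
  let ?Z = "{c \<in> chains K p :: ('a list \<Rightarrow> 'r) set. boundary c = (\<lambda>_. 0)}"
  let ?B = "boundary ` chains K (p + 1) :: ('a list \<Rightarrow> 'r) set"
  let ?G = "cycle_group K p :: ('a list \<Rightarrow> 'r) monoid"
  have carr: "carrier ?G = ?Z" and mult: "\<And>c d. c \<otimes>\<^bsub>?G\<^esub> d = (\<lambda>xs. c xs + d xs)"
    and one: "\<one>\<^bsub>?G\<^esub> = (\<lambda>_. 0)"
    by (simp_all add: cycle_group_def chain_group_def)
  have neg: "(\<lambda>xs. - c xs) \<in> ?Z" if "c \<in> ?Z" for c
  proof -
    have c: "c \<in> chains K p" "boundary c = (\<lambda>_. 0)" using that by auto
    show ?thesis
      using chains_diff[OF zero_in_chains c(1)] boundary_diff[OF V zero_in_chains c(1)] c(2)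
      by (simp add: boundary_zero)
  qed
  interpret G: comm_group ?G
  proof (rule comm_groupI)
    fix c d assume "c \<in> carrier ?G" "d \<in> carrier ?G"
    then show "c \<otimes>\<^bsub>?G\<^esub> d \<in> carrier ?G"
      unfolding carr mult by (auto simp: chains_add boundary_add[OF V, of _ p])
  next
    show "\<one>\<^bsub>?G\<^esub> \<in> carrier ?G"
      unfolding carr one by (simp add: zero_in_chains boundary_zero)
  next
    fix c assume c: "c \<in> carrier ?G"
    show "\<exists>d\<in>carrier ?G. d \<otimes>\<^bsub>?G\<^esub> c = \<one>\<^bsub>?G\<^esub>"
      using neg[of c] c unfolding carr mult one by (intro bexI[of _ "\<lambda>xs. - c xs"]) simp_all
  qed (simp_all add: mult one add_ac)
  have BZ: "?B \<subseteq> ?Z"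
    using boundary_in_chains[OF V K] boundary_boundary[OF V K] by blast
  have "subgroup ?B ?G"
  proof (rule G.subgroupI)
    show "?B \<subseteq> carrier ?G" unfolding carr by (rule BZ)
    show "?B \<noteq> {}" using zero_in_chains by blast
  next
    fix b assume "b \<in> ?B"
    then obtain c where c: "c \<in> chains K (p + 1)" "b = boundary c" by blast
    have b: "b \<in> ?Z" using \<open>b \<in> ?B\<close> BZ by blast
    have "inv\<^bsub>?G\<^esub> b = (\<lambda>xs. - b xs)"
      by (rule G.inv_equality) (use neg[OF b] b in \<open>simp_all add: mult one carr\<close>)
    also have "\<dots> = boundary (\<lambda>xs. 0 - c xs)"
      using boundary_diff[OF V zero_in_chains c(1)] c(2) by (simp add: boundary_zero)
    finally show "inv\<^bsub>?G\<^esub> b \<in> ?B"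
      using chains_diff[OF zero_in_chains c(1)] by blast
  next
    fix b b' assume "b \<in> ?B" "b' \<in> ?B"
    then obtain c c' where c: "c \<in> chains K (p + 1)" "b = boundary c"
      and c': "c' \<in> chains K (p + 1)" "b' = boundary c'" by blast
    then show "b \<otimes>\<^bsub>?G\<^esub> b' \<in> ?B"
      using boundary_add[OF V c(1) c'(1)] chains_add[OF c(1) c'(1)]
      unfolding mult c(2) c'(2) by (metis image_eqI)
  qed
  then have norm: "?B \<lhd> ?G" by (rule G.subgroup_imp_normal)
  interpret Q: Group.group "?G Mod ?B" by (rule normal.factorgroup_is_group[OF norm])
  \<comment> \<open>A cycle represents the neutral coset exactly when it is a boundary.\<close>
  have "?B #>\<^bsub>?G\<^esub> c = ?B \<longleftrightarrow> c \<in> ?B" if "c \<in> carrier ?G" for c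
    using G.coset_join1[OF _ that \<open>subgroup ?B ?G\<close>] G.coset_join2[OF that \<open>subgroup ?B ?G\<close>]
    by argo
  then have "trivial_group (?G Mod ?B) \<longleftrightarrow> carrier ?G \<subseteq> ?B"
    unfolding Q.trivial_group_subset carrier_FactGroup one_FactGroup image_subset_iff singleton_iff
    by (simp only: subset_eq[of "carrier ?G"] cong: ball_cong)
  then show ?thesis
    unfolding reduced_homology_group_def acyclic_at_def carr by blast
qed

lemma acyclic_at_below_hconn:
  fixes K :: "'a set set"
  assumes "finite V" "K \<subseteq> Pow V" "subset_closed K" "enat n < hconn TYPE('r::ring_1) K"
  shows "acyclic_at TYPE('r) K (int n - 1)"
proof (rule ccontr)
  assume "\<not> acyclic_at TYPE('r) K (int n - 1)"
  then have "hconn TYPE('r) K \<le> enat n"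
    unfolding hconn_def trivial_homology_iff[OF assms(1-3)] by (auto intro!: Inf_lower)
  with assms(4) show False by simp
qed

text \<open>A finite infimum in \<open>enat\<close> is attained: the set is nonempty because
  \<open>Inf {}\<close> is \<infinity>. The hypothesis \<open>K \<noteq> {}\<close> excludes the
  case in which the value \<open>0\<close> is set by convention.\<close>

lemma not_acyclic_at_hconn:
  fixes K :: "'a set set"
  assumes "finite V" "K \<subseteq> Pow V" "subset_closed K" "K \<noteq> {}" "hconn TYPE('r::ring_1) K = enat n"
  shows "\<not> acyclic_at TYPE('r) K (int n - 1)"
proof -
  let ?A = "{enat k | k. \<not> acyclic_at TYPE('r) K (int k - 1)}"
  have Inf: "Inf ?A = enat n"
    using assms(4,5) unfolding hconn_def trivial_homology_iff[OF assms(1-3)] by simp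
  then have "?A \<noteq> {}"
    unfolding Inf_enat_def by (metis (no_types, lifting) enat.distinct(1))
  then have "Inf ?A \<in> ?A" unfolding Inf_enat_def by (auto intro: LeastI)
  with Inf show ?thesis by auto
qed

section \<open>Deleting an open star\<close>

text \<open>There is at most one candidate for \<open>THE\<close>, since a permutation of
  \<open>set xs\<close> is determined by its values on the entries of \<open>xs\<close>.\<close>

definition reordering_sign :: "'a list \<Rightarrow> 'a list \<Rightarrow> int" where
  "reordering_sign xs ys = sign (THE \<pi>. \<pi> permutes set xs \<and> map \<pi> xs = ys)"

lemma reordering_sign_map:
  assumes "\<pi> permutes set xs"
  shows "reordering_sign xs (map \<pi> xs) = sign \<pi>"
proof -
  have "(THE \<rho>. \<rho> permutes set xs \<and> map \<rho> xs = map \<pi> xs) = \<pi>"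
  proof (rule the_equality)
    fix \<rho> assume "\<rho> permutes set xs \<and> map \<rho> xs = map \<pi> xs"
    then show "\<rho> = \<pi>" using assms permutes_eq_if_map_eq by blast
  qed (use assms in simp)
  then show ?thesis by (simp add: reordering_sign_def)
qed

text \<open>The join of \<open>u\<close> with the oriented simplex \<open>cs\<close>, oriented so that its value at \<open>ys @ cs\<close> is \<open>u ys\<close>.\<close>

definition join_simplex :: "'a list \<Rightarrow> ('a list \<Rightarrow> 'r::ring_1) \<Rightarrow> 'a list \<Rightarrow> 'r" where
  "join_simplex cs u xs =
    (let ys = filter (\<lambda>x. x \<notin> set cs) xs in
     if distinct xs \<and> set cs \<subseteq> set xs then of_int (reordering_sign xs (ys @ cs)) * u ys else 0)"

lemma join_simplex_append:
  assumes "distinct (ys @ cs)"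
  shows "join_simplex cs u (ys @ cs) = u ys"
proof -
  have "filter (\<lambda>x. x \<notin> set cs) ys = ys"
    by (rule filter_True) (use assms in auto)
  then have "filter (\<lambda>x. x \<notin> set cs) (ys @ cs) = ys" by simp
  moreover have "reordering_sign (ys @ cs) (ys @ cs) = 1"
    using reordering_sign_map[OF permutes_id, of "ys @ cs"] by simp
  ultimately show ?thesis using assms unfolding join_simplex_def Let_def by simp
qed

lemma join_simplex_in_chains:
  fixes u :: "'a list \<Rightarrow> 'r::ring_1"
  assumes V: "finite V" "K \<subseteq> Pow V" and cs: "distinct cs"
    and u: "u \<in> chains L p" and L: "\<And>T. T \<in> L \<Longrightarrow> T \<union> set cs \<in> K"
  shows "join_simplex cs u \<in> chains K (p + int (length cs))"
  unfolding chains_iff[OF V]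
proof (intro conjI allI impI)
  fix xs assume nz: "join_simplex cs u xs \<noteq> 0"
  define ys where "ys = filter (\<lambda>x. x \<notin> set cs) xs"
  from nz have xs: "distinct xs" "set cs \<subseteq> set xs" and ys: "u ys \<noteq> 0"
    by (auto simp: join_simplex_def Let_def ys_def split: if_splits)
  show "distinct xs" by fact
  have set_xs: "set xs = set ys \<union> set cs" using xs by (auto simp: ys_def)
  then show "set xs \<in> K" using L chains_support(2)[OF u ys] by simp
  have "distinct (ys @ cs)" using xs(1) cs by (auto simp: ys_def)
  then have "length xs = length (ys @ cs)"
    using distinct_card[OF xs(1)] distinct_card[of "ys @ cs"] set_xs by simp
  then show "int (length xs) = p + int (length cs) + 1"
    using chains_support(3)[OF u ys] by simp
next
  fix xs :: "'a list" and \<pi> assume xs: "distinct xs" and \<pi>: "\<pi> permutes set xs"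
  let ?F = "filter (\<lambda>x. x \<notin> set cs)"
  have set_xs': "set (map \<pi> xs) = set xs" using \<pi> by (simp add: permutes_image)
  have xs': "distinct (map \<pi> xs)" using xs \<pi> by (simp add: distinct_map permutes_inj_on)
  show "join_simplex cs u (map \<pi> xs) = of_int (sign \<pi>) * join_simplex cs u xs"
  proof (cases "set cs \<subseteq> set xs")
    case False
    then show ?thesis using set_xs' by (simp add: join_simplex_def Let_def del: set_map)
  next
    case True
    have "set xs = set (?F xs @ cs)" using True by auto
    moreover have "distinct (?F xs @ cs)" using xs cs by auto
    ultimately obtain \<rho> where \<rho>: "\<rho> permutes set xs" "map \<rho> xs = ?F xs @ cs"
      using ex_map_permutes[OF xs, of "?F xs @ cs"] by blast
    have "set (map \<pi> xs) = set (?F (map \<pi> xs) @ cs)" using True set_xs' by auto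
    moreover have "distinct (?F (map \<pi> xs) @ cs)" using xs' cs by auto
    ultimately obtain \<rho>' where \<rho>': "\<rho>' permutes set xs" "map \<rho>' (map \<pi> xs) = ?F (map \<pi> xs) @ cs"
      using ex_map_permutes[OF xs', of "?F (map \<pi> xs) @ cs"] unfolding set_xs' by blast
    have "set (?F xs) = set (?F (map \<pi> xs))" using set_xs' by (simp only: set_filter)
    moreover have "distinct (?F xs)" "distinct (?F (map \<pi> xs))" 
      using xs xs' by (simp_all only: distinct_filter)
    ultimately obtain \<tau> where \<tau>: "\<tau> permutes set (?F xs)" "map \<tau> (?F xs) = ?F (map \<pi> xs)"
      using ex_map_permutes[of "?F xs" "?F (map \<pi> xs)"] by blast
    have \<tau>xs: "\<tau> permutes set xs" using \<tau>(1) by (rule permutes_subset) auto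
    have "map \<tau> cs = cs"
      by (rule map_idI) (use permutes_not_in[OF \<tau>(1)] in auto)
    \<comment> \<open>Two routes from \<open>xs\<close> to the normal form of
      \<open>map \<pi> xs\<close>: normalize and then apply \<tau> to the part outside
      \<open>cs\<close>, or apply \<pi> and then normalize. Equality of the permutations gives the
      relation between the signs, which are their own inverses.\<close>
    then have "map (\<tau> \<circ> \<rho>) xs = map (\<rho>' \<circ> \<pi>) xs"
      by (simp only: map_map[symmetric] \<rho>(2) \<rho>'(2) map_append \<tau>(2))
    then have "\<tau> \<circ> \<rho> = \<rho>' \<circ> \<pi>"
      by (rule permutes_eq_if_map_eq[OF permutes_compose[OF \<rho>(1) \<tau>xs] permutes_compose[OF \<pi> \<rho>'(1)]])
    moreover have "permutation \<tau>" "permutation \<rho>" "permutation \<rho>'" "permutation \<pi>"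
      using \<tau>xs \<rho>(1) \<rho>'(1) \<pi> by (auto intro: permutes_imp_permutation[of "set xs"])
    ultimately have "sign \<tau> * sign \<rho> = sign \<rho>' * sign \<pi>"
      using sign_compose[of \<tau> \<rho>] sign_compose[of \<rho>' \<pi>] by simp
    then have "sign \<rho>' * sign \<tau> = sign \<pi> * sign \<rho>"
      by (cases \<tau> rule: sign_cases; cases \<rho> rule: sign_cases;
          cases \<rho>' rule: sign_cases; cases \<pi> rule: sign_cases) auto
    moreover have "reordering_sign xs (?F xs @ cs) = sign \<rho>"
      using reordering_sign_map[OF \<rho>(1)] unfolding \<rho>(2) .
    moreover have "reordering_sign (map \<pi> xs) (?F (map \<pi> xs) @ cs) = sign \<rho>'"
      using reordering_sign_map[of \<rho>' "map \<pi> xs"] \<rho>'(1) unfolding \<rho>'(2) set_xs' by blast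
    moreover have "u (?F (map \<pi> xs)) = of_int (sign \<tau>) * u (?F xs)"
      using chains_map[OF u _ \<tau>(1)] xs unfolding \<tau>(2) by simp
    ultimately show ?thesis
      using xs xs' True unfolding join_simplex_def Let_def set_xs'
      by (simp only: if_True simp_thms flip: mult.assoc of_int_mult)
  qed
qed

text \<open>
  A face of \<open>K\<close> containing \<open>C\<close> is recovered from its link part, so relative chains modulo
  the deletion of the open star of \<open>C\<close> are chains of the link shifted by \<open>card C\<close>.
\<close>

lemma bounds_after_star_deletion:
  fixes z :: "'a list \<Rightarrow> 'r::ring_1"
  defines "link K C \<equiv> {T. T \<inter> C = {} \<and> T \<union> C \<in> K}"
  assumes V: "finite V" "K \<subseteq> Pow V" and K: "subset_closed K" and C: "C \<in> K"
    and z: "z \<in> chains {S \<in> K. \<not> C \<subseteq> S} p" "z \<in> boundary ` chains K (p + 1)"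
    and link: "acyclic_at TYPE('r) (link K C) (p + 1 - int (card C))"
  shows "z \<in> boundary ` chains {S \<in> K. \<not> C \<subseteq> S} (p + 1)"
proof -
  let ?K' = "{S \<in> K. \<not> C \<subseteq> S}" and ?L = "link K C"
  have VL: "?L \<subseteq> Pow V" and VK': "?K' \<subseteq> Pow V"
    using V(2) by (auto simp: link_def)
  have "finite C" using C V by (meson PowD finite_subset subsetD)
  then obtain cs where cs: "set cs = C" "distinct cs"
    using finite_distinct_list by blast
  have len: "int (length cs) = int (card C)" using cs by (simp add: distinct_card flip: cs(1))
  obtain w where w: "w \<in> chains K (p + 1)" "z = boundary w" using z(2) by blast
  \<comment> \<open>The part of \<open>w\<close> on faces containing \<open>C\<close>, read as a
    chain of the link. Since \<open>boundary\<close> prepends vertices, appending \<open>cs\<close>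
    at the end commutes with it without a sign.\<close>
  let ?w = "\<lambda>ys. w (ys @ cs)"
  have wL: "?w \<in> chains ?L (p + 1 - int (card C))"
    unfolding chains_iff[OF V(1) VL]
  proof (intro conjI allI impI)
    fix ys assume "w (ys @ cs) \<noteq> 0"
    from chains_support[OF w(1) this] show "distinct ys" "set ys \<in> ?L"
      "int (length ys) = p + 1 - int (card C) + 1"
      using cs len by (auto simp: link_def)
  next
    fix ys :: "'a list" and \<pi> assume ys: "distinct ys" and \<pi>: "\<pi> permutes set ys"
    show "w (map \<pi> ys @ cs) = of_int (sign \<pi>) * w (ys @ cs)"
    proof (cases "distinct (ys @ cs)")
      case True
      have "map \<pi> cs = cs"
        by (rule map_idI) (use permutes_not_in[OF \<pi>] True in auto)
      moreover have "\<pi> permutes set (ys @ cs)" using \<pi> by (rule permutes_subset) auto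
      ultimately show ?thesis using chains_map[OF w(1) True] by (metis map_append)
    next
      case False
      then have "\<not> distinct (map \<pi> ys @ cs)"
        using ys cs \<pi> by (auto simp: permutes_image)
      with False have "w (ys @ cs) = 0" "w (map \<pi> ys @ cs) = 0"
        using chains_support(1)[OF w(1)] by blast+
      then show ?thesis by simp
    qed
  qed
  \<comment> \<open>It is a cycle because \<open>z\<close> has no support on faces containing
    \<open>C\<close>.\<close>
  have "boundary ?w = (\<lambda>_. 0)"
  proof
    fix ys
    have "boundary ?w ys = z (ys @ cs)"
      using boundary_eq_sum[OF V(1) VL wL] boundary_eq_sum[OF V w(1)] w(2) by simp
    also have "\<dots> = 0" using chains_support(2)[OF z(1), of "ys @ cs"] cs by auto
    finally show "boundary ?w ys = 0" .
  qed
  with wL link obtain u where u: "u \<in> chains ?L (p + 1 - int (card C) + 1)" "?w = boundary u"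
    unfolding acyclic_at_def by blast
  \<comment> \<open>Subtracting the boundary of this join from \<open>w\<close> leaves the boundary
    \<open>z\<close> unchanged and cancels \<open>w\<close> on all lists ending in
    \<open>cs\<close>.\<close>
  let ?U = "join_simplex cs u"
  have "?U \<in> chains K (p + 1 - int (card C) + 1 + int (length cs))"
    by (rule join_simplex_in_chains[OF V cs(2) u(1)]) (simp add: link_def cs)
  then have U: "?U \<in> chains K (p + 1 + 1)" by (simp add: len algebra_simps)
  let ?w' = "\<lambda>xs. w xs - boundary ?U xs"
  have dU: "boundary ?U \<in> chains K (p + 1)"
    by (rule boundary_in_chains[OF V K U])
  have w': "?w' \<in> chains K (p + 1)" by (rule chains_diff[OF w(1) dU])
  have vanish: "?w' (ys @ cs) = 0" for ys
  proof -
    have "?U (x # ys @ cs) = u (x # ys)" for x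
    proof (cases "distinct (x # ys @ cs)")
      case True
      then show ?thesis using join_simplex_append[of "x # ys" cs u] by simp
    next
      case False
      \<comment> \<open>On a list with a repetition the join is zero by definition, and
        \<open>u\<close> is zero because faces of the link avoid \<open>C\<close>.\<close>
      then have "\<not> (distinct (x # ys) \<and> set (x # ys) \<inter> C = {})" using cs by auto
      then have "u (x # ys) = 0" using chains_support[OF u(1)] unfolding link_def by blast
      then show ?thesis
        using False by (simp add: join_simplex_def Let_def del: distinct.simps distinct_append)
    qed
    then have "boundary ?U (ys @ cs) = boundary u ys"
      using boundary_eq_sum[OF V U] boundary_eq_sum[OF V(1) VL u(1)] by simp
    then show ?thesis using u(2) by (simp add: fun_eq_iff)
  qed
  \<comment> \<open>By alternation it suffices to look at lists ending in \<open>cs\<close>: every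
    ordering of a face containing \<open>C\<close> is a rearrangement of one.\<close>
  have "\<not> C \<subseteq> set xs" if nz: "?w' xs \<noteq> 0" for xs
  proof
    assume sub: "C \<subseteq> set xs"
    let ?ys = "filter (\<lambda>x. x \<notin> set cs) xs"
    have xs: "distinct xs" by (rule chains_support(1)[OF w' nz])
    have dist: "distinct (?ys @ cs)" and "set (?ys @ cs) = set xs" using xs cs sub by auto
    then obtain \<pi> where \<pi>: "\<pi> permutes set (?ys @ cs)" "map \<pi> (?ys @ cs) = xs"
      using ex_map_permutes[OF _ xs, of "?ys @ cs"] by blast
    have "?w' xs = of_int (sign \<pi>) * ?w' (?ys @ cs)"
      using chains_map[OF w' dist \<pi>(1)] unfolding \<pi>(2) .
    then show False using nz unfolding vanish by simp
  qed
  with w' have "?w' \<in> chains ?K' (p + 1)"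
    unfolding chains_iff[OF V] chains_iff[OF V(1) VK'] by blast
  moreover have "boundary ?w' = z"
    using boundary_diff[OF V w(1) dU] boundary_boundary[OF V K U] w(2) by simp
  ultimately show ?thesis by blast
qed

section \<open>Matroids\<close>

lemma matroid_subset_closed: "matroid V M \<Longrightarrow> subset_closed M"
  by (auto simp: matroid_def subset_closed_def)

lemma ex_circuit_subset:
  assumes "finite V" "S \<subseteq> V" "S \<notin> M"
  shows "\<exists>e. circuit V M e \<and> e \<subseteq> S"
proof -
  have "finite S" using assms finite_subset by blast
  then show ?thesis using assms(2,3)
  proof (induction S rule: finite_psubset_induct)
    case (psubset S)
    show ?case
    proof (cases "\<forall>D. D \<subset> S \<longrightarrow> D \<in> M")
      case True
      then show ?thesis using psubset.prems by (auto simp: circuit_def)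
    next
      case False
      then obtain D where "D \<subset> S" "D \<notin> M" by blast
      then obtain e where "circuit V M e" "e \<subseteq> D" using psubset by blast
      then show ?thesis using \<open>D \<subset> S\<close> by blast
    qed
  qed
qed

lemma indep_iff_no_circuit:
  assumes "finite V" "subset_closed M" "S \<subseteq> V"
  shows "S \<in> M \<longleftrightarrow> \<not> (\<exists>e. circuit V M e \<and> e \<subseteq> S)"
proof
  assume "S \<in> M"
  then show "\<not> (\<exists>e. circuit V M e \<and> e \<subseteq> S)"
    using subset_closedD[OF assms(2)] unfolding circuit_def by blast
next
  assume "\<not> (\<exists>e. circuit V M e \<and> e \<subseteq> S)"
  then show "S \<in> M" using ex_circuit_subset[OF assms(1,3)] by blast
qed

lemma circuit_subset_eq: "circuit V M C \<Longrightarrow> circuit V M D \<Longrightarrow> C \<subseteq> D \<Longrightarrow> C = D"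
  by (auto simp: circuit_def)

lemma matroid_extend:
  assumes V: "finite V" and M: "matroid V M" and "I \<in> M" "J \<in> M" "card I \<le> card J"
  shows "\<exists>I'\<in>M. I \<subseteq> I' \<and> I' \<subseteq> I \<union> J \<and> card I' = card J"
  using assms(3-5)
proof (induction "card J - card I" arbitrary: I)
  case 0
  then show ?case by (intro bexI[of _ I]) auto
next
  case (Suc n)
  then have "card I < card J" by simp
  then obtain x where x: "x \<in> J - I" "insert x I \<in> M"
    using M Suc.prems unfolding matroid_def by blast
  have "finite I" using V M Suc.prems(1) by (meson PowD finite_subset matroid_def subsetD)
  then have "n = card J - card (insert x I)" "card (insert x I) \<le> card J"
    using x(1) Suc.hyps(2) \<open>card I < card J\<close> by auto
  from Suc.hyps(1)[OF this(1) x(2) Suc.prems(2) this(2)] x(1) show ?case by blast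
qed

text \<open>If no such circuit exists, \<open>C \<union> D - {v}\<close> is independent. Then
  \<open>C - {x}\<close>, with \<open>x\<close> in \<open>C\<close> but not in \<open>D\<close>,
  extends inside \<open>C \<union> D\<close> to an independent set of that size. This set contains
  neither circuit, so it misses \<open>x\<close> and also some \<open>y\<close> in \<open>D\<close>:
  two elements, where its size allows only one.\<close>

lemma circuit_elimination:
  assumes V: "finite V" and M: "matroid V M"
    and C: "circuit V M C" "v \<in> C" and D: "circuit V M D" "v \<in> D" and "C \<noteq> D"
  shows "\<exists>e. circuit V M e \<and> v \<notin> e \<and> e \<subseteq> C \<union> D"
proof (rule ccontr)
  assume no: "\<not> ?thesis"
  have sub: "C \<subseteq> V" "D \<subseteq> V" using C D by (auto simp: circuit_def)
  then have fin: "finite (C \<union> D)" using V finite_subset by blast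
  have J: "C \<union> D - {v} \<in> M"
  proof (rule ccontr)
    assume "C \<union> D - {v} \<notin> M"
    moreover have "C \<union> D - {v} \<subseteq> V" using sub by blast
    ultimately obtain e where "circuit V M e" "e \<subseteq> C \<union> D - {v}"
      using ex_circuit_subset[OF V, of "C \<union> D - {v}" M] by blast
    with no show False by blast
  qed
  obtain x where x: "x \<in> C" "x \<notin> D"
    using circuit_subset_eq[OF C(1) D(1)] \<open>C \<noteq> D\<close> by blast
  have I: "C - {x} \<in> M" using C x by (auto simp: circuit_def)
  have "card (C - {x}) \<le> card (C \<union> D - {v})"
    using x C fin by (simp add: card_Diff_singleton card_mono diff_le_mono)
  from matroid_extend[OF V M I J this] obtain I' where
    I': "I' \<in> M" "C - {x} \<subseteq> I'" "I' \<subseteq> C \<union> D" "card I' = card (C \<union> D - {v})"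
    using C(2) by blast
  have "\<not> C \<subseteq> I'" "\<not> D \<subseteq> I'"
    using subset_closedD[OF matroid_subset_closed[OF M] I'(1)] C D by (auto simp: circuit_def)
  then obtain y where y: "y \<in> D" "y \<notin> I'" and "x \<notin> I'" using I'(2) by blast
  then have "x \<noteq> y" using x(2) by blast
  have "I' \<subseteq> C \<union> D - {x, y}" using y(2) \<open>x \<notin> I'\<close> I'(3) by blast
  then have "card I' \<le> card (C \<union> D - {x, y})" using fin by (simp add: card_mono)
  also have "\<dots> = card (C \<union> D) - card {x, y}"
    using x y by (intro card_Diff_subset) auto
  also have "card {x, y} = 2" using \<open>x \<noteq> y\<close> by simp
  finally have "card (C \<union> D) - 1 \<le> card (C \<union> D) - 2"
    using I'(4) C(2) fin by (simp add: card_Diff_singleton)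
  \<comment> \<open>Subtraction on naturals truncates, so the contradiction requires a union of at
    least two elements.\<close>
  moreover have "card (C \<union> D) \<ge> card {x, y}"
    using x y fin by (intro card_mono) auto
  ultimately show False using \<open>x \<noteq> y\<close> by simp
qed

text \<open>An independent \<open>C\<close> contains no circuit, so the side condition on
  \<open>e\<close> always holds and the contraction is the link of \<open>C\<close>. The clause
  \<open>T \<subseteq> V\<close> is stated because \<open>M\<close> itself is not assumed to lie in
  \<open>Pow V\<close>.\<close>

lemma contraction_indep:
  assumes V: "finite V" and M: "subset_closed M" "C \<in> M" "C \<subseteq> V"
  shows "contraction V M C = {T. T \<inter> C = {} \<and> T \<union> C \<in> M \<and> T \<subseteq> V}"
proof -
  have "\<not> e \<subseteq> C" if "circuit V M e" for e
    using that subset_closedD[OF M(1,2)] by (auto simp: circuit_def)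
  then have "contraction V M C = {T. T \<subseteq> V - C \<and> \<not> (\<exists>e. circuit V M e \<and> e \<subseteq> T \<union> C)}"
    unfolding contraction_def by (auto simp: Diff_subset_conv Un_commute)
  also have "\<dots> = {T. T \<subseteq> V - C \<and> T \<union> C \<in> M}"
  proof (intro Collect_cong conj_cong refl)
    fix T assume "T \<subseteq> V - C"
    then have "T \<union> C \<subseteq> V" using M(3) by blast
    then show "(\<not> (\<exists>e. circuit V M e \<and> e \<subseteq> T \<union> C)) = (T \<union> C \<in> M)"
      using indep_iff_no_circuit[OF V M(1)] by simp
  qed
  finally show ?thesis by blast
qed

text \<open>Contracting a circuit through \<open>v\<close> gives its link in
  \<open>drop_circuits V M v\<close>. A circuit through \<open>v\<close> other than \<open>C\<close>
  can be exchanged, by elimination against \<open>C\<close>, for one avoiding \<open>v\<close>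
  inside the union. Conversely a circuit avoiding \<open>v\<close> is not contained in
  \<open>C\<close>, by minimality.\<close>

lemma contraction_circuit:
  assumes V: "finite V" and M: "matroid V M" and C: "circuit V M C" "v \<in> C"
  shows "contraction V M C = {T. T \<inter> C = {} \<and> T \<union> C \<in> drop_circuits V M v}"
proof -
  have "C \<subseteq> V" using C by (auto simp: circuit_def)
  have "(\<exists>e. circuit V M e \<and> \<not> e \<subseteq> C \<and> e - C \<subseteq> T) \<longleftrightarrow>
        (\<exists>e. circuit V M e \<and> v \<notin> e \<and> e \<subseteq> T \<union> C)" for T
  proof
    assume "\<exists>e. circuit V M e \<and> \<not> e \<subseteq> C \<and> e - C \<subseteq> T"
    then obtain e where e: "circuit V M e" "\<not> e \<subseteq> C" "e - C \<subseteq> T" by blast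
    show "\<exists>e. circuit V M e \<and> v \<notin> e \<and> e \<subseteq> T \<union> C"
    proof (cases "v \<in> e")
      case True
      then show ?thesis using circuit_elimination[OF V M C e(1)] e by blast
    qed (use e in blast)
  next
    assume "\<exists>e. circuit V M e \<and> v \<notin> e \<and> e \<subseteq> T \<union> C"
    then obtain e where e: "circuit V M e" "v \<notin> e" "e \<subseteq> T \<union> C" by blast
    then have "\<not> e \<subseteq> C" using circuit_subset_eq[OF e(1) C(1)] C(2) by blast
    with e show "\<exists>e. circuit V M e \<and> \<not> e \<subseteq> C \<and> e - C \<subseteq> T" by blast
  qed
  moreover have "T \<subseteq> V - C \<longleftrightarrow> T \<inter> C = {} \<and> T \<union> C \<subseteq> V" for T
    using \<open>C \<subseteq> V\<close> by blast
  ultimately show ?thesis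
    unfolding contraction_def drop_circuits_def by simp
qed

theorem theorem3p5:
  fixes V :: "'a set" and v :: 'a and k :: nat and M :: "nat \<Rightarrow> 'a set set"
  assumes "finite V" and "v \<in> V" and "k \<ge> 1"
    and "\<And>i. i \<in> {1..k} \<Longrightarrow> matroid V (M i)"
  shows "hconn TYPE('r::ring_1) (\<Inter>i\<in>{1..k}. M i)
           \<ge> hconn TYPE('r) (drop_circuits V (M 1) v \<inter> (\<Inter>i\<in>{2..k}. M i))
       \<or> (\<exists>C. C \<subseteq> V \<and> v \<in> C \<and> circuit V (M 1) C \<and> C \<in> (\<Inter>i\<in>{2..k}. M i) \<and>
            hconn TYPE('r) (\<Inter>i\<in>{1..k}. M i)
              \<ge> hconn TYPE('r) (\<Inter>i\<in>{1..k}. contraction V (M i) C) + enat (card C - 1))"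
proof (rule ccontr)
  let ?K = "\<Inter>i\<in>{1..k}. M i" and ?N = "drop_circuits V (M 1) v \<inter> (\<Inter>i\<in>{2..k}. M i)"
  \<comment> \<open>The candidates for the required set, and also the circuits whose open stars have
    to be deleted from \<open>?N\<close>.\<close>
  define \<C> where "\<C> = {C. circuit V (M 1) C \<and> v \<in> C \<and> C \<in> (\<Inter>i\<in>{2..k}. M i)}"
  let ?lk = "\<lambda>C. \<Inter>i\<in>{1..k}. contraction V (M i) C"
  assume "\<not> ?thesis"
  then have N: "hconn TYPE('r) ?K < hconn TYPE('r) ?N"
    and lk: "\<And>C. C \<in> \<C> \<Longrightarrow> hconn TYPE('r) ?K < hconn TYPE('r) (?lk C) + enat (card C - 1)"
    by (auto simp: \<C>_def not_le circuit_def)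
  obtain n where n: "hconn TYPE('r) ?K = enat n" using N by (cases "hconn TYPE('r) ?K") auto
  have split: "{1..k} = insert 1 {2..k}" using assms(3) by auto
  have M1: "matroid V (M 1)" and Mi: "\<And>i. i \<in> {2..k} \<Longrightarrow> matroid V (M i)"
    using assms(3,4) by auto
  have clM: "\<And>i. i \<in> {1..k} \<Longrightarrow> subset_closed (M i)" "subset_closed (M 1)"
    using assms(4) M1 matroid_subset_closed by blast+
  \<comment> \<open>A circuit of \<open>M 1\<close> inside a face of \<open>?N\<close> must pass
    through \<open>v\<close>, and it lies in the other matroids because the face does.\<close>
  have KN: "?K = {S \<in> ?N. \<forall>C\<in>\<C>. \<not> C \<subseteq> S}"
  proof (intro equalityI subsetI)
    fix S assume S: "S \<in> ?K"
    then have "S \<in> M 1" "S \<in> (\<Inter>i\<in>{2..k}. M i)" using assms(3) by auto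
    moreover have "S \<subseteq> V" using \<open>S \<in> M 1\<close> M1 by (auto simp: matroid_def)
    ultimately show "S \<in> {S \<in> ?N. \<forall>C\<in>\<C>. \<not> C \<subseteq> S}"
      using indep_iff_no_circuit[OF assms(1) clM(2), of S]
      unfolding drop_circuits_def \<C>_def by blast
  next
    fix S assume S: "S \<in> {S \<in> ?N. \<forall>C\<in>\<C>. \<not> C \<subseteq> S}"
    then have "S \<subseteq> V" by (auto simp: drop_circuits_def)
    have "C \<in> \<C>" if C: "circuit V (M 1) C" "C \<subseteq> S" for C
    proof -
      have "v \<in> C" using C S unfolding drop_circuits_def by blast
      moreover have "C \<in> M i" if "i \<in> {2..k}" for i
      proof (rule subset_closedD[OF clM(1) _ C(2)])
        show "S \<in> M i" using S that by blast
        show "i \<in> {1..k}" using that by simp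
      qed
      ultimately show ?thesis using C(1) unfolding \<C>_def by blast
    qed
    then have "\<not> (\<exists>C. circuit V (M 1) C \<and> C \<subseteq> S)" using S by blast
    then have "S \<in> M 1"
      using indep_iff_no_circuit[OF assms(1) clM(2) \<open>S \<subseteq> V\<close>] by simp
    then show "S \<in> ?K" using S unfolding split by blast
  qed
  have VN: "?N \<subseteq> Pow V" and VK: "?K \<subseteq> Pow V"
    unfolding KN by (auto simp: drop_circuits_def)
  have clN: "subset_closed ?N"
  proof (intro subset_closed_Int subset_closed_INT)
    show "subset_closed (drop_circuits V (M 1) v)"
      unfolding subset_closed_def drop_circuits_def by blast
  qed (use clM(1) in simp)
  have clK: "subset_closed ?K" by (intro subset_closed_INT clM(1))
  have "{} \<in> M i" if "i \<in> {1..k}" for i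
    using assms(4)[OF that] unfolding matroid_def by blast
  then have "{} \<in> ?K" by blast
  then have "\<not> acyclic_at TYPE('r) ?K (int n - 1)"
    using not_acyclic_at_hconn[OF assms(1) VK clK _ n] by blast
  then obtain z :: "'a list \<Rightarrow> 'r" where z: "z \<in> chains ?K (int n - 1)" "boundary z = (\<lambda>_. 0)"
    "z \<notin> boundary ` chains ?K (int n - 1 + 1)"
    unfolding acyclic_at_def by blast
  \<comment> \<open>The same \<open>z\<close> is followed through all complexes between
    \<open>?K\<close> and \<open>?N\<close>.\<close>
  have mono: "z \<in> chains A (int n - 1)" if "?K \<subseteq> A" for A
    using z(1) that by (auto simp: chains_def)
  have zN: "z \<in> boundary ` chains ?N (int n - 1 + 1)"
  proof -
    have "acyclic_at TYPE('r) ?N (int n - 1)"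
      using acyclic_at_below_hconn[OF assms(1) VN clN] N n by simp
    then show ?thesis using z(2) mono[of ?N] KN unfolding acyclic_at_def by blast
  qed
  have "\<C> \<subseteq> Pow V" by (auto simp: \<C>_def circuit_def)
  then have "finite \<C>" using assms(1) by (meson finite_Pow_iff finite_subset)
  \<comment> \<open>Stars are deleted one circuit at a time while \<open>z\<close> stays a boundary;
    \<open>\<D> = \<C>\<close> reaches \<open>?K\<close> and contradicts the choice of
    \<open>z\<close>.\<close>
  moreover have "z \<in> boundary ` chains {S \<in> ?N. \<forall>C\<in>\<D>. \<not> C \<subseteq> S} (int n - 1 + 1)"
    if "finite \<D>" "\<D> \<subseteq> \<C>" for \<D>
    using that
  proof (induction \<D> rule: finite_induct)
    case empty
    have "{S \<in> ?N. \<forall>C\<in>{}. \<not> C \<subseteq> S} = ?N" by blast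
    then show ?case using zN by (simp only:)
  next
    case (insert C \<D>)
    let ?K' = "{S \<in> ?N. \<forall>C\<in>\<D>. \<not> C \<subseteq> S}"
    have C: "circuit V (M 1) C" "v \<in> C" "C \<in> (\<Inter>i\<in>{2..k}. M i)" "C \<in> \<C>" "C \<subseteq> V"
      using insert.prems by (auto simp: \<C>_def circuit_def)
    \<comment> \<open>Elimination of \<open>v\<close> from two such circuits would leave a circuit
      avoiding \<open>v\<close> in a face of \<open>?N\<close>.\<close>
    have unique: "D = C" if D: "D \<in> \<C>" "S \<in> ?N" "C \<subseteq> S" "D \<subseteq> S" for D S
    proof (rule ccontr)
      assume "D \<noteq> C"
      then obtain e where "circuit V (M 1) e" "v \<notin> e" "e \<subseteq> D \<union> C"
        using circuit_elimination[OF assms(1) M1 _ _ C(1,2)] D(1) unfolding \<C>_def by blast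
      then show False using D(2-4) unfolding drop_circuits_def by blast
    qed
    have "C \<in> drop_circuits V (M 1) v"
      using C(2,5) circuit_subset_eq[OF _ C(1)] unfolding drop_circuits_def by blast
    then have CN: "C \<in> ?N" using C(3) by blast
    \<comment> \<open>The earlier deletions do not touch the star of \<open>C\<close>, so its link
      in \<open>?K'\<close> is still its link in \<open>?N\<close>.\<close>
    have K': "S \<in> ?K'" if "S \<in> ?N" "C \<subseteq> S" for S
    proof (intro CollectI conjI ballI notI)
      fix D assume D: "D \<in> \<D>" "D \<subseteq> S"
      then have "D \<in> \<C>" using insert.prems by blast
      then have "D = C" using unique that D(2) by blast
      with D(1) insert.hyps(2) show False by blast
    qed (rule that(1))
    have cl': "subset_closed ?K'" by (rule subset_closed_avoiding[OF clN])
    have V': "?K' \<subseteq> Pow V" using VN by blast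
    have link_N: "T \<in> ?lk C \<longleftrightarrow> T \<inter> C = {} \<and> T \<union> C \<in> ?N" for T
    proof -
      have "contraction V (M i) C = {T. T \<inter> C = {} \<and> T \<union> C \<in> M i \<and> T \<subseteq> V}" if "i \<in> {2..k}" for i
        using C(3) that
        by (intro contraction_indep[OF assms(1) matroid_subset_closed[OF Mi[OF that]] _ C(5)]) blast
      then have "T \<in> ?lk C \<longleftrightarrow> (T \<inter> C = {} \<and> T \<union> C \<in> drop_circuits V (M 1) v) \<and>
          (\<forall>i\<in>{2..k}. T \<inter> C = {} \<and> T \<union> C \<in> M i \<and> T \<subseteq> V)"
        unfolding split by (simp add: contraction_circuit[OF assms(1) M1 C(1,2), simplified])
      moreover have "T \<subseteq> V" if "T \<union> C \<in> drop_circuits V (M 1) v"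
        using that by (simp add: drop_circuits_def)
      ultimately show ?thesis by auto
    qed
    have link: "{T. T \<inter> C = {} \<and> T \<union> C \<in> ?K'} = ?lk C"
    proof (intro equalityI subsetI)
      fix T assume "T \<in> {T. T \<inter> C = {} \<and> T \<union> C \<in> ?K'}"
      then show "T \<in> ?lk C" unfolding link_N by blast
    next
      fix T assume "T \<in> ?lk C"
      then have "T \<inter> C = {}" "T \<union> C \<in> ?N" unfolding link_N by blast+
      with K'[of "T \<union> C"] show "T \<in> {T. T \<inter> C = {} \<and> T \<union> C \<in> ?K'}" by blast
    qed
    have cllk: "subset_closed (?lk C)"
      unfolding link[symmetric] by (rule subset_closed_link[OF cl'])
    have Vlk: "?lk C \<subseteq> Pow V"
      using V' unfolding link[symmetric] by blast
    have "finite C" using C(5) assms(1) finite_subset by blast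
    then have "card C \<ge> 1" using C(2) by (auto simp: Suc_le_eq card_gt_0_iff)
    \<comment> \<open>Degree \<open>n - card C\<close> corresponds to connectivity index
      \<open>n + 1 - card C\<close>. If this is negative, the degree is below \<open>-1\<close> and
      there are no nonzero chains. Otherwise the failure of (iv) for \<open>C\<close> puts the index
      strictly below the connectivity of the link.\<close>
    have ac: "acyclic_at TYPE('r) (?lk C) (int n - 1 + 1 - int (card C))"
    proof (cases "n + 1 < card C")
      case True
      then show ?thesis by (intro acyclic_at_below) simp
    next
      case False
      then have "enat (n + 1 - card C) < hconn TYPE('r) (?lk C)"
        using lk[OF C(4)] n \<open>card C \<ge> 1\<close> by (cases "hconn TYPE('r) (?lk C)") auto
      from acyclic_at_below_hconn[OF assms(1) Vlk cllk this] False show ?thesis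
        by (simp add: of_nat_diff algebra_simps)
    qed
    have eq: "{S \<in> ?K'. \<not> C \<subseteq> S} = {S \<in> ?N. \<forall>C\<in>insert C \<D>. \<not> C \<subseteq> S}" by blast
    have zK': "z \<in> chains {S \<in> ?K'. \<not> C \<subseteq> S} (int n - 1)"
      by (rule mono) (use KN insert.prems in blast)
    have "z \<in> boundary ` chains {S \<in> ?K'. \<not> C \<subseteq> S} (int n - 1 + 1)"
    proof (rule bounds_after_star_deletion[OF assms(1) V' cl' K'[OF CN order.refl] zK'])
      show "z \<in> boundary ` chains ?K' (int n - 1 + 1)"
        using insert.IH insert.prems by blast
    qed (use ac in \<open>simp only: link\<close>)
    then show ?case unfolding eq .
  qed
  ultimately show False using z(3) unfolding KN by blast
qed

end
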